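(* Let $X$ and $Y$ be Tychonoff spaces such that $C_p(X)$ and $C_p(Y)$ are linearly homeomorphic. Then $X$ is projectively Hurewicz if and only if $Y$ is projectively Hurewicz.
   Context: $C_p(X)$ denotes the vector space of all continuous real-valued functions on $X$ with the topology of pointwise convergence. $C_p(X)$ and $C_p(Y)$ are linearly homeomorphic if there is a linear bijection $C_p(X)\to C_p(Y)$ that is a homeomorphism. A topological space $X$ is Hurewicz if for every sequence $(\mathscr{U}_n)_{n\in\mathbb{N}}$ of open covers of $X$ there is a sequence $(\mathscr{V}_n)_{n\in\mathbb{N}}$ such that each $\mathscr{V}_n$ is a finite subfamily of $\mathscr{U}_n$ and every point of $X$ belongs to $\bigcup\mathscr{V}_n$ for all but finitely many $n$. A space $X$ is projectively Hurewicz if every separable metrizable continuous image of $X$ is Hurewicz. *)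

theory Defs
  imports "HOL-Analysis.Analysis"
begin

definition Tychonoff_space :: "'a topology \<Rightarrow> bool" where
  "Tychonoff_space X \<longleftrightarrow> completely_regular_space X \<and> Hausdorff_space X"

(* A continuous function on X is represented by its extensional representative (undefined
   outside the carrier), so that elements of C(X) correspond one-to-one to real-valued
   functions on topspace X. *)
definition C_fun :: "'a topology \<Rightarrow> ('a \<Rightarrow> real) set" where
  "C_fun X = {f. f \<in> extensional (topspace X) \<and> continuous_map X euclideanreal f}"

definition Cp :: "'a topology \<Rightarrow> ('a \<Rightarrow> real) topology" where
  "Cp X = subtopology (product_topology (\<lambda>x. euclideanreal) (topspace X)) (C_fun X)"

definition Cp_add :: "'a topology \<Rightarrow> ('a \<Rightarrow> real) \<Rightarrow> ('a \<Rightarrow> real) \<Rightarrow> 'a \<Rightarrow> real" where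
  "Cp_add X f g = (\<lambda>x\<in>topspace X. f x + g x)"

definition Cp_scale :: "'a topology \<Rightarrow> real \<Rightarrow> ('a \<Rightarrow> real) \<Rightarrow> 'a \<Rightarrow> real" where
  "Cp_scale X c f = (\<lambda>x\<in>topspace X. c * f x)"

definition Cp_linear :: "'a topology \<Rightarrow> 'b topology \<Rightarrow> (('a \<Rightarrow> real) \<Rightarrow> ('b \<Rightarrow> real)) \<Rightarrow> bool" where
  "Cp_linear X Y \<phi> \<longleftrightarrow>
     (\<forall>f\<in>C_fun X. \<forall>g\<in>C_fun X. \<phi> (Cp_add X f g) = Cp_add Y (\<phi> f) (\<phi> g)) \<and>
     (\<forall>c. \<forall>f\<in>C_fun X. \<phi> (Cp_scale X c f) = Cp_scale Y c (\<phi> f))"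

definition Cp_linearly_homeomorphic :: "'a topology \<Rightarrow> 'b topology \<Rightarrow> bool" where
  "Cp_linearly_homeomorphic X Y \<longleftrightarrow>
     (\<exists>\<phi>. Cp_linear X Y \<phi> \<and> homeomorphic_map (Cp X) (Cp Y) \<phi>)"

definition open_cover :: "'a topology \<Rightarrow> 'a set set \<Rightarrow> bool" where
  "open_cover X \<U> \<longleftrightarrow> (\<forall>U\<in>\<U>. openin X U) \<and> \<Union>\<U> = topspace X"

definition Hurewicz_space :: "'a topology \<Rightarrow> bool" where
  "Hurewicz_space X \<longleftrightarrow>
     (\<forall>\<U> :: nat \<Rightarrow> 'a set set. (\<forall>n. open_cover X (\<U> n)) \<longrightarrow>
        (\<exists>\<V> :: nat \<Rightarrow> 'a set set. (\<forall>n. finite (\<V> n) \<and> \<V> n \<subseteq> \<U> n) \<and>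
           (\<forall>x\<in>topspace X. finite {n. x \<notin> \<Union>(\<V> n)})))"

(* The images Z range over topologies on the type of X only. This loses nothing: a surjective
   image of X has at most as many points as X, hence a homeomorphic copy on that type; see
   projectively_Hurewicz_image below. *)
definition projectively_Hurewicz :: "'a topology \<Rightarrow> bool" where
  "projectively_Hurewicz X \<longleftrightarrow>
     (\<forall>(Z :: 'a topology) f. continuous_map X Z f \<and> f ` topspace X = topspace Z \<and>
        separable_space Z \<and> metrizable_space Z \<longrightarrow> Hurewicz_space Z)"

lemma topspace_Cp: "topspace (Cp X) = C_fun X"
  by (auto simp: Cp_def C_fun_def PiE_def)

lemma Hurewicz_space_continuous_image:
  assumes X: "Hurewicz_space X" and f: "continuous_map X Z f" "f ` topspace X = topspace Z"
  shows "Hurewicz_space Z"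
  unfolding Hurewicz_space_def
proof (intro allI impI)
  fix \<U> :: "nat \<Rightarrow> 'b set set"
  assume U: "\<forall>n. open_cover Z (\<U> n)"
  define p where "p = (\<lambda>U. {x \<in> topspace X. f x \<in> U})"
  have "open_cover X (p ` \<U> n)" for n
  proof -
    have "openin X (p V)" if "V \<in> \<U> n" for V
      using U that f(1) by (auto simp: p_def open_cover_def openin_continuous_map_preimage)
    moreover have "\<Union> (p ` \<U> n) = topspace X"
    proof -
      have "f x \<in> \<Union> (\<U> n)" if "x \<in> topspace X" for x
        using U that f(2) by (auto simp: open_cover_def)
      then show ?thesis
        by (fastforce simp: p_def)
    qed
    ultimately show ?thesis
      by (auto simp: open_cover_def)
  qed
  then have cov: "\<forall>n. open_cover X ((\<lambda>n. p ` \<U> n) n)"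
    by simp
  obtain \<W> where W': "\<forall>n. finite (\<W> n) \<and> \<W> n \<subseteq> p ` \<U> n"
      and W: "\<forall>x\<in>topspace X. finite {n. x \<notin> \<Union>(\<W> n)}"
    using X[unfolded Hurewicz_space_def, THEN spec, THEN mp, OF cov] by (elim exE conjE)
  have "\<exists>V \<subseteq> \<U> n. finite V \<and> \<W> n = p ` V" for n
    using W' finite_subset_image[of "\<W> n" p "\<U> n"] by auto
  then have "\<forall>n. \<exists>V. V \<subseteq> \<U> n \<and> finite V \<and> \<W> n = p ` V"
    by simp
  then obtain \<V> where V: "\<forall>n. \<V> n \<subseteq> \<U> n \<and> finite (\<V> n) \<and> \<W> n = p ` \<V> n"
    by (rule choice[THEN exE])
  have "finite {n. z \<notin> \<Union>(\<V> n)}" if z: "z \<in> topspace Z" for z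
  proof -
    obtain x where x: "x \<in> topspace X" "z = f x"
      using z f(2) by (metis imageE)
    have "{n. z \<notin> \<Union>(\<V> n)} \<subseteq> {n. x \<notin> \<Union>(\<W> n)}"
      using V x by (auto simp: p_def)
    then show ?thesis
      using W x(1) finite_subset by blast
  qed
  then show "\<exists>\<V>. (\<forall>n. finite (\<V> n) \<and> \<V> n \<subseteq> \<U> n) \<and> (\<forall>z\<in>topspace Z. finite {n. z \<notin> \<Union>(\<V> n)})"
    using V by blast
qed

lemma projectively_Hurewicz_image:
  fixes X :: "'a topology" and Z :: "'b topology"
  assumes X: "projectively_Hurewicz X"
    and f: "continuous_map X Z f" "f ` topspace X = topspace Z"
    and Z: "separable_space Z" "metrizable_space Z"
  shows "Hurewicz_space Z"
proof -
  define g where "g = inv_into (topspace X) f"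
  have fg: "f (g z) = z" "g z \<in> topspace X" if "z \<in> topspace Z" for z
    using that f(2) by (auto simp: g_def f_inv_into_f inv_into_into)
  define A where "A = g ` topspace Z"
  define T where "T = pullback_topology A f Z"
  have T: "topspace T = A"
    using fg by (auto simp: T_def topspace_pullback_topology A_def)
  have cf: "continuous_map T Z f"
    using continuous_map_pullback[of Z Z id A f] by (simp add: T_def)
  have cg: "continuous_map Z T g"
    unfolding T_def
  proof (rule continuous_map_pullback')
    show "continuous_map Z Z (f \<circ> g)"
      using fg by (auto intro: continuous_map_eq[of Z Z id])
  qed (auto simp: A_def)
  have hom: "homeomorphic_maps T Z f g"
    using cf cg fg T by (auto simp: homeomorphic_maps_def A_def)
  then have TZ: "T homeomorphic_space Z"
    by (auto simp: homeomorphic_space_def)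
  have "continuous_map X T (g \<circ> f)"
    using f(1) cg continuous_map_compose by blast
  moreover have "(g \<circ> f) ` topspace X = topspace T"
    using f(2) T A_def by (metis image_comp)
  moreover have "separable_space T" "metrizable_space T"
    using TZ Z homeomorphic_separable_space homeomorphic_metrizable_space by blast+
  ultimately have "Hurewicz_space T"
    using X unfolding projectively_Hurewicz_def by blast
  moreover have "f ` topspace T = topspace Z"
    using fg by (force simp: T A_def image_image)
  ultimately show ?thesis
    using cf Hurewicz_space_continuous_image by blast
qed

end

theory Submission
  imports Defs
begin

text \<open>Call a sequence of continuous real functions on $X$ dominated if some real sequence $b$
satisfies $|h_n(x)| \le b_n$ for every $x$ and all but finitely many $n$. Then $X$ is projectively
Hurewicz if and only if every such sequence is dominated. For the forward direction, apply the
Hurewicz property to the image of $X$ in $\mathbb{R}^{\mathbb{N}}$. For the backward direction,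
an increasing open cover $(W_k)$ of a metrizable space admits a continuous function that is at
least $k$ outside $W_k$.

Domination passes through a linear homeomorphism $\varphi$: evaluation of $\varphi f$ at $y$ is
bounded by $M_y \max_{F_y} |f|$ for a finite set $F_y$, so if $b > 0$ dominates
$\varphi^{-1}(h_n)$, then $n b_n$ dominates $h_n$, because $n \ge M_y$ eventually.\<close>

definition seq_dominated :: "'a topology \<Rightarrow> bool" where
  "seq_dominated X \<longleftrightarrow>
     (\<forall>h :: nat \<Rightarrow> 'a \<Rightarrow> real. (\<forall>n. continuous_map X euclideanreal (h n)) \<longrightarrow>
        (\<exists>b :: nat \<Rightarrow> real. \<forall>x\<in>topspace X. \<forall>\<^sub>F n in sequentially. \<bar>h n x\<bar> \<le> b n))"

section \<open>Separable metrizable spaces: countable subcovers and exhaustion functions\<close>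

text \<open>The balls of radius \<open>1 / (n + 1)\<close> around the points of a countable dense
  set form a countable base, and second countability yields countable subcovers.\<close>

lemma separable_metrizable_imp_Lindelof_space:
  assumes "separable_space Z" "metrizable_space Z"
  shows "Lindelof_space Z"
proof -
  obtain M d where "Metric_space M d" and Z: "Z = Metric_space.mtopology M d"
    using assms(2) metrizable_space_def by blast
  then interpret Metric_space M d by simp
  obtain C where C: "countable C" "C \<subseteq> M" "mtopology closure_of C = M"
    using assms(1) by (auto simp: separable_space_def Z)
  define \<B> where "\<B> = (\<lambda>(c, n). mball c (inverse (real (Suc n)))) ` (C \<times> UNIV)"
  have "\<exists>V\<in>\<B>. x \<in> V \<and> V \<subseteq> U" if U: "openin mtopology U" "x \<in> U" for U x
  proof -
    obtain r where r: "r > 0" "mball x r \<subseteq> U"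
      using U by (auto simp: openin_mtopology)
    have xM: "x \<in> M"
      using U openin_mtopology by blast
    \<comment> \<open>Half of \<open>r\<close> pays for the distance from \<open>x\<close> to a
      dense point \<open>c\<close>, the other half for the radius of the ball around
      \<open>c\<close>.\<close>
    obtain n where n: "inverse (real (Suc n)) < r / 2"
      using r reals_Archimedean[of "r / 2"] by auto
    have "x \<in> mtopology closure_of C"
      using C xM by simp
    then obtain c where c: "c \<in> C" "c \<in> mball x (inverse (real (Suc n)))"
      unfolding metric_closure_of by (smt (verit) inverse_positive_iff_positive mem_Collect_eq of_nat_0_less_iff zero_less_Suc)
    have "mball c (inverse (real (Suc n))) \<subseteq> mball x r"
    proof
      fix z assume "z \<in> mball c (inverse (real (Suc n)))"
      then have "d x z \<le> d x c + d c z" "d c z < r / 2" "z \<in> M"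
        using triangle[of x c z] xM n by auto
      moreover have "d x c < r / 2"
        using c n by auto
      ultimately show "z \<in> mball x r"
        using xM by simp
    qed
    moreover have "x \<in> mball c (inverse (real (Suc n)))"
      using c xM by (auto simp: commute)
    ultimately show ?thesis
      using r(2) c(1) by (auto simp: \<B>_def)
  qed
  moreover have "countable \<B>"
    using C by (simp add: \<B>_def)
  moreover have "\<forall>V\<in>\<B>. openin mtopology V"
    by (auto simp: \<B>_def)
  ultimately have "second_countable mtopology"
    unfolding second_countable_def by blast
  then show ?thesis
    by (simp add: Z second_countable_imp_Lindelof_space)
qed

text \<open>The witness is \<open>1 / s\<close>, where \<open>s z\<close> is the supremum of the radii \<open>r \<le> 1 / (k + 1)\<close> such
  that the ball of radius \<open>r\<close> around \<open>z\<close> lies in \<open>W k\<close>; the function \<open>s\<close> is 1-Lipschitz.\<close>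
lemma metrizable_exhaustion_function:
  fixes W :: "nat \<Rightarrow> 'a set"
  assumes "metrizable_space Z"
    and "\<And>k. openin Z (W k)" and "mono W" and "(\<Union>k. W k) = topspace Z"
  obtains h :: "'a \<Rightarrow> real" where "continuous_map Z euclideanreal h"
    and "\<And>z k. \<lbrakk>z \<in> topspace Z; h z < real k\<rbrakk> \<Longrightarrow> z \<in> W k"
proof -
  obtain M d where "Metric_space M d" and Z: "Z = Metric_space.mtopology M d"
    using assms(1) metrizable_space_def by blast
  then interpret Metric_space M d by simp
  \<comment> \<open>Admitting \<open>r = 0\<close> makes the supremum range over a nonempty set and
    gives \<open>s z \<ge> 0\<close> before positivity is known.\<close>
  define R where "R z = {r. r = 0 \<or> (0 < r \<and> (\<exists>k. r \<le> 1 / real (Suc k) \<and> mball z r \<subseteq> W k))}" for z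
  define s where "s z = Sup (R z)" for z
  have zero: "0 \<in> R z" for z
    by (simp add: R_def)
  have le1: "r \<le> 1" if "r \<in> R z" for r z
  proof -
    have "1 / real (Suc k) \<le> 1" for k
      by simp
    then show ?thesis
      using that unfolding R_def by (smt (verit, best) mem_Collect_eq)
  qed
  have bdd: "bdd_above (R z)" for z
    using le1 by (meson bdd_above.I)
  have lip: "s z \<le> s w + d z w" if zw: "z \<in> M" "w \<in> M" for z w
    unfolding s_def[of z]
  proof (rule cSup_least)
    fix r assume r: "r \<in> R z"
    show "r \<le> s w + d z w"
    proof (cases "r > d z w")
      case True
      then have "r > 0"
        using nonneg[of z w] by linarith
      then obtain k where k: "r \<le> 1 / real (Suc k)" "mball z r \<subseteq> W k"
        using r by (auto simp: R_def)
      \<comment> \<open>Moving the centre from \<open>z\<close> to \<open>w\<close> costs at most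
        \<open>d z w\<close> of the radius, which is the Lipschitz estimate. If
        \<open>r \<le> d z w\<close>, the estimate follows from \<open>s w \<ge> 0\<close>.\<close>
      have "mball w (r - d z w) \<subseteq> mball z r"
      proof
        fix v assume "v \<in> mball w (r - d z w)"
        then show "v \<in> mball z r"
          using triangle[of z w v] zw by auto
      qed
      then have "mball w (r - d z w) \<subseteq> W k"
        using k(2) by blast
      moreover have "r - d z w \<le> 1 / real (Suc k)"
        using k(1) nonneg[of z w] by linarith
      ultimately have "r - d z w \<in> R w"
        using True unfolding R_def by auto
      then have "r - d z w \<le> s w"
        using bdd by (simp add: s_def cSup_upper)
      then show ?thesis
        by simp
    next
      case False
      moreover have "0 \<le> s w"
        using bdd zero by (simp add: s_def cSup_upper)
      ultimately show ?thesis
        by simp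
    qed
  qed (use zero in blast)
  have pos: "0 < s z" if z: "z \<in> M" for z
  proof -
    obtain k where k: "z \<in> W k"
      using z assms(4) Z by auto
    then obtain r where r: "r > 0" "mball z r \<subseteq> W k"
      using assms(2)[of k] by (auto simp: Z openin_mtopology)
    define t where "t = min r (1 / real (Suc k))"
    have t: "t > 0" "t \<le> r" "t \<le> 1 / real (Suc k)"
      using r by (auto simp: t_def)
    then have "mball z t \<subseteq> W k"
      using r(2) mball_subset_concentric by blast
    then have "t \<in> R z"
      using t by (auto simp: R_def)
    then have "t \<le> s z"
      using bdd by (simp add: s_def cSup_upper)
    then show ?thesis
      using t(1) by linarith
  qed
  have "continuous_map mtopology euclideanreal s"
    unfolding continuous_map_from_metric
  proof (intro conjI ballI allI impI)
    fix a U assume a: "a \<in> M" and U: "openin euclideanreal U \<and> s a \<in> U"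
    then obtain e where e: "e > 0" "\<And>t. dist t (s a) < e \<Longrightarrow> t \<in> U"
      by (metis open_dist open_openin)
    have "s x \<in> U" if x: "x \<in> M" "d a x < e" for x
      using lip[of a x] lip[of x a] x a commute[of a x] by (intro e) (auto simp: dist_real_def)
    then show "\<exists>r>0. \<forall>x. x \<in> M \<and> d a x < r \<longrightarrow> s x \<in> U"
      using e(1) by blast
  qed auto
  then have "continuous_map Z euclideanreal (\<lambda>z. inverse (s z))"
    using pos by (intro continuous_map_real_inverse) (fastforce simp: Z)+
  moreover have "z \<in> W k" if z: "z \<in> topspace Z" and k: "inverse (s z) < real k" for z k
  proof -
    have zM: "z \<in> M"
      using z Z by simp
    have k0: "real k > 0"
      using k pos[OF zM] by (smt (verit) inverse_positive_iff_positive)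
    \<comment> \<open>Some radius in \<open>R z\<close> exceeds \<open>1 / k\<close>. It belongs to
      an index \<open>j\<close> with \<open>1 / k < 1 / (j + 1)\<close>, so \<open>j < k\<close>,
      and \<open>W j\<close> is contained in \<open>W k\<close>.\<close>
    have "1 / real k < s z"
      using k pos[OF zM] k0 by (simp add: field_simps)
    then obtain r where r: "r \<in> R z" "1 / real k < r"
      using zero bdd less_cSup_iff[of "R z"] unfolding s_def by blast
    then have "r > 0"
      using k0 by (smt (verit) divide_pos_pos)
    then obtain j where j: "r \<le> 1 / real (Suc j)" "mball z r \<subseteq> W j"
      using r(1) by (auto simp: R_def)
    have "1 / real k < 1 / real (Suc j)"
      using j r by linarith
    then have "j \<le> k"
      using k0 by (simp add: field_simps)
    then show ?thesis
      using j(2) \<open>r > 0\<close> zM assms(3) by (meson centre_in_mball_iff monoD subsetD)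
  qed
  ultimately show ?thesis
    using that by blast
qed

section \<open>Projectively Hurewicz spaces are those with dominated sequences\<close>

lemma seq_dominatedD:
  fixes h :: "nat \<Rightarrow> 'a \<Rightarrow> real"
  assumes "seq_dominated X" "\<And>n. continuous_map X euclideanreal (h n)"
  obtains b :: "nat \<Rightarrow> real"
  where "\<And>x. x \<in> topspace X \<Longrightarrow> \<forall>\<^sub>F n in sequentially. \<bar>h n x\<bar> \<le> b n"
  using assms(1)[unfolded seq_dominated_def, THEN spec, of h] assms(2) by auto

text \<open>The map \<open>H\<close> sends \<open>x\<close> to the sequence of all
  \<open>h n x\<close>. On its image the sets \<open>U n k\<close>, where the \<open>n\<close>-th
  coordinate is below \<open>k\<close> in absolute value, form a cover for each \<open>n\<close>; a
  finite subfamily amounts to one bound \<open>b n\<close>.\<close>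

lemma projectively_Hurewicz_imp_seq_dominated:
  assumes X: "projectively_Hurewicz X"
  shows "seq_dominated X"
  unfolding seq_dominated_def
proof (intro allI impI)
  fix h :: "nat \<Rightarrow> 'a \<Rightarrow> real"
  assume h: "\<forall>n. continuous_map X euclideanreal (h n)"
  define H where "H x n = h n x" for x n
  define Z where "Z = subtopology euclidean (H ` topspace X)"
  have topZ: "topspace Z = H ` topspace X"
    by (simp add: Z_def)
  have "continuous_map X euclidean H"
    unfolding euclidean_product_topology[symmetric] using h
    by (intro continuous_map_coordinatewise_then_product) (auto simp: H_def)
  then have "continuous_map X Z H"
    by (simp add: Z_def continuous_map_in_subtopology)
  \<comment> \<open>Separability need not pass to subspaces, so it is derived from second
    countability, which does.\<close>
  moreover have "second_countable (euclidean :: (nat \<Rightarrow> real) topology)"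
  proof -
    obtain B :: "(nat \<Rightarrow> real) set set" where B: "countable B" "\<And>C. C \<in> B \<Longrightarrow> open C"
      "\<And>S. open S \<Longrightarrow> \<exists>U. U \<subseteq> B \<and> S = \<Union>U"
      using univ_second_countable by blast
    then show ?thesis
      unfolding second_countable_def open_openin[symmetric] by (intro exI[of _ B]) blast
  qed
  then have "separable_space Z"
    by (simp add: Z_def second_countable_imp_separable_space second_countable_subtopology)
  moreover have "metrizable_space Z"
    by (simp add: Z_def metrizable_space_subtopology metrizable_space_euclidean)
  ultimately have Z: "Hurewicz_space Z"
    using projectively_Hurewicz_image[OF X] topZ by metis
  define U where "U n k = {z \<in> topspace Z. \<bar>z n\<bar> < real k}" for n k
  have cover: "\<forall>n. open_cover Z (range (U n))"
  proof
    fix n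
    have "continuous_map Z euclideanreal (\<lambda>z. \<bar>z n\<bar>)"
      unfolding Z_def
      by (auto intro!: continuous_intros continuous_on_subset[OF continuous_on_product_coordinates])
    then have "openin Z {z \<in> topspace Z. \<bar>z n\<bar> \<in> {..<real k}}" for k
      by (rule openin_continuous_map_preimage) auto
    moreover have "(\<Union>k. U n k) = topspace Z"
      using reals_Archimedean2 by (auto simp: U_def)
    ultimately show "open_cover Z (range (U n))"
      by (auto simp: open_cover_def U_def)
  qed
  obtain \<V> where V: "\<forall>n. finite (\<V> n) \<and> \<V> n \<subseteq> range (U n)"
    and fin: "\<forall>z\<in>topspace Z. finite {n. z \<notin> \<Union>(\<V> n)}"
    using Z[unfolded Hurewicz_space_def, THEN spec, THEN mp, OF cover] by (elim exE conjE)
  \<comment> \<open>The sets \<open>U n k\<close> increase with \<open>k\<close>, so the largest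
    index suffices. For empty \<open>K\<close> the value of \<open>Max K\<close> is unspecified, but
    the union is empty.\<close>
  have "\<exists>b::nat. \<Union>(\<V> n) \<subseteq> U n b" for n
  proof -
    obtain K where K: "finite K" "\<V> n = U n ` K"
      using V finite_subset_image[of "\<V> n" "U n" UNIV] by auto
    have "U n k \<subseteq> U n (Max K)" if "k \<in> K" for k
    proof -
      have "real k \<le> real (Max K)"
        using K(1) that by simp
      then show ?thesis
        by (auto simp: U_def)
    qed
    then show ?thesis
      unfolding K(2) by (intro exI[of _ "Max K"] UN_least)
  qed
  then obtain b :: "nat \<Rightarrow> nat" where b: "\<And>n. \<Union>(\<V> n) \<subseteq> U n (b n)"
    by metis
  have "\<forall>\<^sub>F n in sequentially. \<bar>h n x\<bar> \<le> real (b n)" if x: "x \<in> topspace X" for x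
  proof -
    have "finite {n. H x \<notin> \<Union>(\<V> n)}"
      using fin x topZ by blast
    then have "\<forall>\<^sub>F n in sequentially. H x \<in> \<Union>(\<V> n)"
      by (simp add: eventually_cofinite flip: cofinite_eq_sequentially)
    then show ?thesis
    proof eventually_elim
      case (elim n)
      then have "H x \<in> U n (b n)"
        using b by blast
      then show ?case
        by (simp add: U_def H_def)
    qed
  qed
  then show "\<exists>b :: nat \<Rightarrow> real. \<forall>x\<in>topspace X. \<forall>\<^sub>F n in sequentially. \<bar>h n x\<bar> \<le> b n"
    by (intro exI[of _ "\<lambda>n. real (b n)"]) blast
qed

text \<open>Each cover of the image has a countable subcover, whose partial unions admit an
  exhaustion function \<open>g n\<close>. A sequence dominating the functions
  \<open>g n \<circ> f\<close> tells how many members to take from each cover.\<close>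

lemma seq_dominated_imp_projectively_Hurewicz:
  assumes X: "seq_dominated X"
  shows "projectively_Hurewicz X"
  unfolding projectively_Hurewicz_def Hurewicz_space_def
proof (intro allI impI, elim conjE)
  fix Z :: "'a topology" and f and \<U> :: "nat \<Rightarrow> 'a set set"
  assume f: "continuous_map X Z f" "f ` topspace X = topspace Z"
    and sep: "separable_space Z" and met: "metrizable_space Z"
    and \<U>: "\<forall>n. open_cover Z (\<U> n)"
  \<comment> \<open>Enumerating by \<open>from_nat_into\<close> requires a nonempty family; adding
    \<open>{}\<close> also handles the empty subcover of an empty \<open>Z\<close>.\<close>
  have "\<exists>V :: nat \<Rightarrow> 'a set. range V \<subseteq> insert {} (\<U> n) \<and> \<Union>(range V) = topspace Z" for n
  proof -
    obtain \<C> where "countable \<C>" "\<C> \<subseteq> \<U> n" "\<Union>\<C> = topspace Z"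
      using \<U> separable_metrizable_imp_Lindelof_space[OF sep met]
      by (metis Lindelof_space_def open_cover_def)
    then show ?thesis
      by (intro exI[of _ "from_nat_into (insert {} \<C>)"]) auto
  qed
  then obtain V :: "nat \<Rightarrow> nat \<Rightarrow> 'a set"
    where V: "\<And>n. range (V n) \<subseteq> insert {} (\<U> n)" "\<And>n. \<Union>(range (V n)) = topspace Z"
    by metis
  have "openin Z (V n i)" for n i
  proof -
    have "V n i \<in> insert {} (\<U> n)"
      using V(1) by blast
    then show ?thesis
      using \<U> by (auto simp: open_cover_def)
  qed
  then have op: "openin Z (\<Union>i\<le>k. V n i)" for n k
    by blast
  have "\<exists>g. continuous_map Z euclideanreal g \<and>
            (\<forall>z\<in>topspace Z. \<forall>k. g z < real k \<longrightarrow> z \<in> (\<Union>i\<le>k. V n i))" for n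
  proof -
    have "mono (\<lambda>k. \<Union>i\<le>k. V n i)"
      by (intro monoI UN_mono) auto
    moreover have "(\<Union>k. \<Union>i\<le>k. V n i) = topspace Z"
      using V(2)[of n] by auto
    ultimately show ?thesis
      by (rule metrizable_exhaustion_function[OF met op]) blast
  qed
  then obtain g where g: "\<And>n. continuous_map Z euclideanreal (g n)"
    "\<And>n z k. \<lbrakk>z \<in> topspace Z; g n z < real k\<rbrakk> \<Longrightarrow> z \<in> (\<Union>i\<le>k. V n i)"
    by metis
  have "continuous_map X euclideanreal (g n \<circ> f)" for n
    using continuous_map_compose[OF f(1) g(1)] .
  then obtain b :: "nat \<Rightarrow> real"
    where b: "\<And>x. x \<in> topspace X \<Longrightarrow> \<forall>\<^sub>F n in sequentially. \<bar>(g n \<circ> f) x\<bar> \<le> b n"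
    using seq_dominatedD[OF X, of "\<lambda>n. g n \<circ> f"] by blast
  \<comment> \<open>The inequality is strict because \<open>g n z < real k\<close> is what places
    \<open>z\<close> in the \<open>k\<close>-th partial union.\<close>
  have "\<forall>n. \<exists>k::nat. b n < real k"
    using reals_Archimedean2 by blast
  then obtain K :: "nat \<Rightarrow> nat" where K: "\<And>n. b n < real (K n)"
    by metis
  \<comment> \<open>Intersecting with \<open>\<U> n\<close> can only remove the padding set
    \<open>{}\<close>, so no point is lost.\<close>
  define \<V> where "\<V> n = V n ` {..K n} \<inter> \<U> n" for n
  have "finite {n. z \<notin> \<Union>(\<V> n)}" if z: "z \<in> topspace Z" for z
  proof -
    obtain x where x: "x \<in> topspace X" "z = f x"
      using z f(2) by auto
    have "\<forall>\<^sub>F n in sequentially. \<bar>g n z\<bar> \<le> b n"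
      using b[OF x(1)] x(2) by simp
    then have "\<forall>\<^sub>F n in sequentially. z \<in> \<Union>(\<V> n)"
    proof eventually_elim
      case (elim n)
      then have "z \<in> (\<Union>i\<le>K n. V n i)"
        using g(2)[OF z, of n "K n"] K[of n] by linarith
      then show ?case
        using V(1)[of n] by (fastforce simp: \<V>_def)
    qed
    then show ?thesis
      by (simp add: eventually_cofinite flip: cofinite_eq_sequentially)
  qed
  then show "\<exists>\<V>. (\<forall>n. finite (\<V> n) \<and> \<V> n \<subseteq> \<U> n) \<and>
                 (\<forall>z\<in>topspace Z. finite {n. z \<notin> \<Union>(\<V> n)})"
    by (intro exI[of _ \<V>]) (auto simp: \<V>_def)
qed

lemma projectively_Hurewicz_iff_seq_dominated:
  "projectively_Hurewicz X \<longleftrightarrow> seq_dominated X"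
  using projectively_Hurewicz_imp_seq_dominated seq_dominated_imp_projectively_Hurewicz by blast

section \<open>Linear operations and continuous functionals on function spaces\<close>

lemma C_fun_add:
  assumes "f \<in> C_fun X" "g \<in> C_fun X"
  shows "Cp_add X f g \<in> C_fun X"
proof -
  have "continuous_map X euclideanreal (\<lambda>x. f x + g x)"
    using assms by (auto simp: C_fun_def intro: continuous_intros)
  then show ?thesis
    by (auto simp: C_fun_def Cp_add_def intro: continuous_map_eq)
qed

lemma C_fun_scale:
  assumes "f \<in> C_fun X"
  shows "Cp_scale X c f \<in> C_fun X"
proof -
  have "continuous_map X euclideanreal (\<lambda>x. c * f x)"
    using assms by (auto simp: C_fun_def intro: continuous_intros)
  then show ?thesis
    by (auto simp: C_fun_def Cp_scale_def intro: continuous_map_eq)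
qed

lemma continuous_map_Cp_eval:
  assumes "y \<in> topspace Y"
  shows "continuous_map (Cp Y) euclideanreal (\<lambda>f. f y)"
  unfolding Cp_def
  by (intro continuous_map_from_subtopology continuous_map_product_projection[OF assms])

text \<open>The functional taking \<open>f\<close> to \<open>\<phi> f y\<close> is continuous, so it
  stays below 1 in absolute value on a basic neighbourhood of zero. Such a neighbourhood restricts
  only finitely many coordinates, which form \<open>F\<close>; homogeneity turns this into a bound
  for every \<open>f\<close>.\<close>

lemma Cp_functional_bound:
  fixes \<phi> :: "('a \<Rightarrow> real) \<Rightarrow> 'b \<Rightarrow> real"
  assumes lin: "Cp_linear X Y \<phi>" and cont: "continuous_map (Cp X) (Cp Y) \<phi>"
    and y: "y \<in> topspace Y"
  obtains F M where "finite F" "F \<subseteq> topspace X"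
    and "\<And>f c. \<lbrakk>f \<in> C_fun X; 0 < c; \<And>x. x \<in> F \<Longrightarrow> \<bar>f x\<bar> \<le> c\<rbrakk> \<Longrightarrow> \<bar>\<phi> f y\<bar> \<le> M * c"
proof -
  have scale: "\<phi> (Cp_scale X c f) y = c * \<phi> f y" if "f \<in> C_fun X" for c f
    using lin that y by (simp add: Cp_linear_def Cp_scale_def)
  define z where "z = (\<lambda>x\<in>topspace X. 0::real)"
  have zC: "z \<in> C_fun X"
    by (auto simp: z_def C_fun_def intro: continuous_map_eq[of _ _ "\<lambda>_. 0"])
  have "Cp_scale X 0 z = z"
    by (auto simp: Cp_scale_def z_def)
  then have z0: "\<phi> z y = 0"
    using scale[OF zC, of 0] by simp
  have "continuous_map (Cp X) euclideanreal (\<lambda>f. \<phi> f y)"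
    using continuous_map_compose[OF cont continuous_map_Cp_eval[OF y]] by (simp add: comp_def)
  then have "openin (Cp X) {f \<in> topspace (Cp X). \<phi> f y \<in> {-1<..<1}}"
    by (rule openin_continuous_map_preimage) auto
  then have "\<exists>T. openin (product_topology (\<lambda>x. euclideanreal) (topspace X)) T \<and>
                 {f \<in> C_fun X. \<phi> f y \<in> {-1<..<1}} = T \<inter> C_fun X"
    unfolding topspace_Cp unfolding Cp_def openin_subtopology .
  then obtain T where T: "openin (product_topology (\<lambda>x. euclideanreal) (topspace X)) T"
    "{f \<in> C_fun X. \<phi> f y \<in> {-1<..<1}} = T \<inter> C_fun X"
    by (elim exE conjE)
  have "z \<in> {f \<in> C_fun X. \<phi> f y \<in> {-1<..<1}}"
    using zC z0 by simp
  then have "z \<in> T"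
    unfolding T(2) by simp
  then have "\<exists>U. finite {x \<in> topspace X. U x \<noteq> UNIV} \<and> (\<forall>x\<in>topspace X. open (U x)) \<and>
                 z \<in> Pi\<^sub>E (topspace X) U \<and> Pi\<^sub>E (topspace X) U \<subseteq> T"
    using T(1) by (simp add: openin_product_topology_alt)
  then obtain U where U: "finite {x \<in> topspace X. U x \<noteq> UNIV}" "\<And>x. x \<in> topspace X \<Longrightarrow> open (U x)"
    "z \<in> Pi\<^sub>E (topspace X) U" "Pi\<^sub>E (topspace X) U \<subseteq> T"
    by blast
  define F where "F = {x \<in> topspace X. U x \<noteq> UNIV}"
  have finF: "finite F" "F \<subseteq> topspace X"
    using U by (auto simp: F_def)
  have "\<exists>e>0. \<forall>t::real. \<bar>t\<bar> < e \<longrightarrow> t \<in> U x" if x: "x \<in> F" for x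
  proof -
    have "0 \<in> U x" "open (U x)"
      using x U(2,3) finF(2) by (auto simp: z_def PiE_iff)
    then have "\<exists>e>0. \<forall>t. dist t 0 < e \<longrightarrow> t \<in> U x"
      unfolding open_dist by blast
    then show ?thesis
      by (simp add: dist_real_def)
  qed
  then obtain e where e: "\<And>x. x \<in> F \<Longrightarrow> e x > 0" "\<And>x t. \<lbrakk>x \<in> F; \<bar>t\<bar> < e x\<rbrakk> \<Longrightarrow> t \<in> U x"
    by metis
  \<comment> \<open>The inserted 1 keeps the minimum meaningful and positive when \<open>F\<close>
    is empty.\<close>
  define \<epsilon> where "\<epsilon> = Min (insert 1 (e ` F))"
  have eps: "\<epsilon> > 0" "\<And>x. x \<in> F \<Longrightarrow> \<epsilon> \<le> e x"
    using finF e(1) by (auto simp: \<epsilon>_def)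
  have small: "\<bar>\<phi> f y\<bar> < 1" if f: "f \<in> C_fun X" "\<And>x. x \<in> F \<Longrightarrow> \<bar>f x\<bar> < \<epsilon>" for f
  proof -
    have "f x \<in> U x" if "x \<in> topspace X" for x
      using that f(2)[of x] e(2)[of x "f x"] eps(2)[of x] by (cases "x \<in> F") (auto simp: F_def)
    then have "f \<in> Pi\<^sub>E (topspace X) U"
      using f(1) by (simp add: C_fun_def PiE_iff)
    then have "f \<in> T \<inter> C_fun X"
      using f(1) U(4) by blast
    then show ?thesis
      unfolding T(2)[symmetric] by auto
  qed
  \<comment> \<open>Scaling \<open>f\<close> by \<open>\<epsilon> / (2 * c)\<close> brings its
    values on \<open>F\<close> down to at most \<open>\<epsilon> / 2\<close>; the factor 2 gives the
    strict inequality that \<open>small\<close> asks for.\<close>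
  have "\<bar>\<phi> f y\<bar> \<le> 2 / \<epsilon> * c"
    if f: "f \<in> C_fun X" "0 < c" "\<And>x. x \<in> F \<Longrightarrow> \<bar>f x\<bar> \<le> c" for f c
  proof -
    define a where "a = \<epsilon> / (2 * c)"
    have a: "a > 0"
      using eps f by (simp add: a_def)
    have "\<bar>Cp_scale X a f x\<bar> < \<epsilon>" if "x \<in> F" for x
    proof -
      have "\<bar>Cp_scale X a f x\<bar> = a * \<bar>f x\<bar>"
        using that finF a by (auto simp: Cp_scale_def abs_mult)
      also have "\<dots> \<le> a * c"
        using a f(3)[OF that] by simp
      also have "\<dots> < \<epsilon>"
        using f eps by (simp add: a_def)
      finally show ?thesis .
    qed
    then have "\<bar>\<phi> (Cp_scale X a f) y\<bar> < 1"
      by (rule small[OF C_fun_scale[OF f(1)]])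
    then have "a * \<bar>\<phi> f y\<bar> < 1"
      using scale[OF f(1)] a by (simp add: abs_mult)
    then show ?thesis
      using f eps by (simp add: a_def field_simps)
  qed
  then show ?thesis
    using that[of F "2 / \<epsilon>"] finF by simp
qed

section \<open>Transfer of domination along linear homeomorphisms\<close>

text \<open>Stated for a continuous linear surjection, so that it applies to a linear homeomorphism
  and to its inverse alike.\<close>

lemma seq_dominated_transfer:
  assumes lin: "Cp_linear X Y \<phi>" and cont: "continuous_map (Cp X) (Cp Y) \<phi>"
    and surj: "\<phi> ` C_fun X = C_fun Y" and X: "seq_dominated X"
  shows "seq_dominated Y"
  unfolding seq_dominated_def
proof (intro allI impI)
  fix h :: "nat \<Rightarrow> 'b \<Rightarrow> real"
  assume h: "\<forall>n. continuous_map Y euclideanreal (h n)"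
  have "restrict (h n) (topspace Y) \<in> C_fun Y" for n
    using h by (auto simp: C_fun_def intro: continuous_map_eq)
  then have "\<exists>g\<in>C_fun X. \<phi> g = restrict (h n) (topspace Y)" for n
    using surj by (metis imageE)
  then obtain g where g: "\<And>n. g n \<in> C_fun X" "\<And>n. \<phi> (g n) = restrict (h n) (topspace Y)"
    by metis
  have "continuous_map X euclideanreal (g n)" for n
    using g(1) by (simp add: C_fun_def)
  then obtain b :: "nat \<Rightarrow> real"
    where b: "\<And>x. x \<in> topspace X \<Longrightarrow> \<forall>\<^sub>F n in sequentially. \<bar>g n x\<bar> \<le> b n"
    using seq_dominatedD[OF X, of g] by blast
  \<comment> \<open>The constant \<open>M\<close> depends on \<open>y\<close>, but the factor
    \<open>n\<close> eventually exceeds each such constant. The term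
    \<open>\<bar>b n\<bar> + 1\<close> supplies the positive \<open>c\<close> of the functional
    bound.\<close>
  have "\<forall>\<^sub>F n in sequentially. \<bar>h n y\<bar> \<le> real n * (\<bar>b n\<bar> + 1)" if y: "y \<in> topspace Y" for y
  proof -
    obtain F M where F: "finite F" "F \<subseteq> topspace X"
      and M: "\<And>f c. \<lbrakk>f \<in> C_fun X; 0 < c; \<And>x. x \<in> F \<Longrightarrow> \<bar>f x\<bar> \<le> c\<rbrakk> \<Longrightarrow> \<bar>\<phi> f y\<bar> \<le> M * c"
      using Cp_functional_bound[OF lin cont y] by metis
    \<comment> \<open>Finiteness of \<open>F\<close> lets the thresholds of its points be merged
      into one.\<close>
    have "\<forall>\<^sub>F n in sequentially. \<forall>x\<in>F. \<bar>g n x\<bar> \<le> b n"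
      using F b by (intro eventually_ball_finite) auto
    moreover have "\<forall>\<^sub>F n in sequentially. M \<le> real n"
      using filterlim_real_sequentially by (simp add: filterlim_at_top)
    ultimately show ?thesis
    proof eventually_elim
      case (elim n)
      have "\<bar>h n y\<bar> = \<bar>\<phi> (g n) y\<bar>"
        using g y by simp
      also have "\<dots> \<le> M * (\<bar>b n\<bar> + 1)"
        using elim(1) by (intro M g) force+
      also have "\<dots> \<le> real n * (\<bar>b n\<bar> + 1)"
        using elim(2) by (intro mult_right_mono) auto
      finally show ?case .
    qed
  qed
  then show "\<exists>b :: nat \<Rightarrow> real. \<forall>y\<in>topspace Y. \<forall>\<^sub>F n in sequentially. \<bar>h n y\<bar> \<le> b n"
    by (intro exI[of _ "\<lambda>n. real n * (\<bar>b n\<bar> + 1)"]) blast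
qed

text \<open>By linearity, \<open>\<phi>\<close> maps the combination formed in
  \<open>C_fun X\<close> to the one formed in \<open>C_fun Y\<close>; applying \<open>\<psi>\<close>
  to both sides gives the claim, since \<open>C_fun X\<close> is closed under the
  operations.\<close>

lemma Cp_linear_inverse:
  assumes lin: "Cp_linear X Y \<phi>" and hom: "homeomorphic_maps (Cp X) (Cp Y) \<phi> \<psi>"
  shows "Cp_linear Y X \<psi>"
proof -
  have inv: "\<And>f. f \<in> C_fun X \<Longrightarrow> \<psi> (\<phi> f) = f" "\<And>g. g \<in> C_fun Y \<Longrightarrow> \<phi> (\<psi> g) = g"
    "\<And>g. g \<in> C_fun Y \<Longrightarrow> \<psi> g \<in> C_fun X"
    using hom by (auto simp: homeomorphic_maps_def topspace_Cp continuous_map_def)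
  show ?thesis
    unfolding Cp_linear_def
  proof (intro conjI ballI allI)
    fix f g assume f: "f \<in> C_fun Y" and g: "g \<in> C_fun Y"
    have "\<phi> (Cp_add X (\<psi> f) (\<psi> g)) = Cp_add Y f g"
      using lin inv f g by (simp add: Cp_linear_def)
    then show "\<psi> (Cp_add Y f g) = Cp_add X (\<psi> f) (\<psi> g)"
      using inv f g C_fun_add by metis
  next
    fix c f assume f: "f \<in> C_fun Y"
    have "\<phi> (Cp_scale X c (\<psi> f)) = Cp_scale Y c f"
      using lin inv f by (simp add: Cp_linear_def)
    then show "\<psi> (Cp_scale Y c f) = Cp_scale X c (\<psi> f)"
      using inv f C_fun_scale by metis
  qed
qed

theorem theorem1p6:
  fixes X :: "'a topology" and Y :: "'b topology"
  assumes "Tychonoff_space X" and "Tychonoff_space Y"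
    and "Cp_linearly_homeomorphic X Y"
  shows "projectively_Hurewicz X \<longleftrightarrow> projectively_Hurewicz Y"
proof -
  obtain \<phi> \<psi> where lin: "Cp_linear X Y \<phi>" and hom: "homeomorphic_maps (Cp X) (Cp Y) \<phi> \<psi>"
    using assms(3) by (auto simp: Cp_linearly_homeomorphic_def homeomorphic_map_maps)
  have cont: "continuous_map (Cp X) (Cp Y) \<phi>" "continuous_map (Cp Y) (Cp X) \<psi>"
    using hom by (auto simp: homeomorphic_maps_def)
  have surj: "\<phi> ` C_fun X = C_fun Y" "\<psi> ` C_fun Y = C_fun X"
    using hom homeomorphic_imp_surjective_map homeomorphic_maps_map topspace_Cp by metis+
  show ?thesis
    unfolding projectively_Hurewicz_iff_seq_dominated
    using seq_dominated_transfer[OF lin cont(1) surj(1)]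
      seq_dominated_transfer[OF Cp_linear_inverse[OF lin hom] cont(2) surj(2)] by blast
qed

end
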